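(* Let $0<L<U$ and $\alpha\ge 1$. Let $\omega$ be a number with $\frac{1}{\alpha}\le\omega\le 1$, and let $\varphi:[\omega,1]\to[0,\infty)$ be an increasing differentiable function satisfying $$\varphi(y)\ge \frac{1}{\alpha}\varphi'(y)\ \text{ for all } y\in[\omega,1],\qquad \varphi(\omega)=L,\qquad \varphi(1)\ge U.$$ Define the threshold function $\phi:[0,1]\to[0,\infty)$ by $\phi(y)=L$ for $y\in[0,\omega]$ and $\phi(y)=\varphi(y)$ for $y\in[\omega,1]$. Then the Unified Algorithm run with threshold function $\phi$ is $\alpha$-competitive for the one-way trading problem, and it is also $\alpha$-competitive for the online knapsack problem (under the infinitesimal weight assumption).
   Context: One-way trading problem (OTP): exchange rates $b_1,\dots,b_N\in[L,U]$ (with $0<L<U$) arrive one at a time; upon seeing $b_i$ (and not future rates, nor $N$) an online algorithm irrevocably chooses $x_i\ge 0$, subject to $\sum_{i=1}^N x_i\le 1$; its gain is $\sum_{i=1}^N b_ix_i$. The offline optimum is $\max\{\sum_i b_ix_i:\sum_i x_i\le 1,x_i\ge 0\}$. Online knapsack problem (OKP): items $i=1,\dots,N$ arrive one at a time with value $v_i>0$ and weight $w_i>0$ revealed upon arrival, where the value-to-weight ratio $b_i=v_i/w_i\in[L,U]$, and (infinitesimal assumption) every weight is infinitesimally small compared to the knapsack capacity $1$. An online algorithm irrevocably decides $z_i\in\{0,1\}$ upon arrival, subject to $\sum_i w_iz_i\le 1$; its gain is $\sum_i v_iz_i$. Write $x_i=w_iz_i$. For an instance $\mathcal A$, let $\mathrm{ALG}(\mathcal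 A)$ and $\mathrm{OPT}(\mathcal A)$ be the online algorithm's gain and the offline optimal gain. The algorithm is $\alpha$-competitive if $\mathrm{OPT}(\mathcal A)/\mathrm{ALG}(\mathcal A)\le\alpha$ for every instance $\mathcal A$. Unified Algorithm with threshold function $\phi:[0,1]\to[0,\infty)$: set $y^{(0)}=0$. For each arrival $i$: (1) choose $x_i\in\arg\max_{x\in\mathbb S} \big(b_ix-\int_{y^{(i-1)}}^{y^{(i-1)}+x}\phi(\delta)\,d\delta\big)$; (2) set $y^{(i)}=y^{(i-1)}+x_i$; (3) if $y^{(i)}>1$, set $x_i=0$. Here $\mathbb S=[0,\infty)$ for the OTP and $\mathbb S=\{0,w_i\}$ for the OKP (so for the OKP the item is accepted iff $b_i\ge\phi(y^{(i-1)})$).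
   Formalization: Ties in the argmax are broken toward the largest maximizer: with arbitrary ties the claim fails (a single rate L allows x=0, with gain 0); infinitesimal weights mean ratio at most α+ε for all sufficiently small weights, for every ε>0. *)

theory Defs
  imports "HOL-Analysis.Analysis"
begin

definition otp_instance :: "real \<Rightarrow> real \<Rightarrow> real list \<Rightarrow> bool" where
  "otp_instance L U bs \<longleftrightarrow> set bs \<subseteq> {L..U}"

definition otp_feasible :: "real list \<Rightarrow> real list \<Rightarrow> bool" where
  "otp_feasible bs xs \<longleftrightarrow> length xs = length bs \<and> (\<forall>x\<in>set xs. 0 \<le> x) \<and> sum_list xs \<le> 1"

definition otp_gain :: "real list \<Rightarrow> real list \<Rightarrow> real" where
  "otp_gain bs xs = sum_list (map2 (*) bs xs)"

text \<open>The set below is nonempty and compact, so the supremum is the maximum.\<close>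
definition otp_opt :: "real list \<Rightarrow> real" where
  "otp_opt bs = Sup {otp_gain bs xs | xs. otp_feasible bs xs}"

text \<open>An algorithm maps the sequence of arrivals to the sequence of decisions. The bound on the
  ratio of \<open>OPT\<close> to \<open>ALG\<close> is written multiplicatively because division by zero yields \<open>0\<close> in HOL: the
  multiplicative form forces \<open>ALG > 0\<close> whenever \<open>OPT > 0\<close> and holds for the empty instance.\<close>
definition otp_competitive ::
    "real \<Rightarrow> real \<Rightarrow> (real list \<Rightarrow> real list) \<Rightarrow> real \<Rightarrow> bool" where
  "otp_competitive L U alg \<alpha> \<longleftrightarrow>
     (\<forall>bs. otp_instance L U bs \<longrightarrow>
        otp_feasible bs (alg bs) \<and> otp_opt bs \<le> \<alpha> * otp_gain bs (alg bs))"

text \<open>Knapsack items are pairs (value, weight); decisions are lists over \<open>{0, 1}\<close>.\<close>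
type_synonym item = "real \<times> real"

definition okp_instance :: "real \<Rightarrow> real \<Rightarrow> item list \<Rightarrow> bool" where
  "okp_instance L U items \<longleftrightarrow> (\<forall>(v, w)\<in>set items. 0 < v \<and> 0 < w \<and> v / w \<in> {L..U})"

definition okp_feasible :: "item list \<Rightarrow> real list \<Rightarrow> bool" where
  "okp_feasible items zs \<longleftrightarrow>
     length zs = length items \<and> set zs \<subseteq> {0, 1} \<and>
     sum_list (map2 (\<lambda>(v, w) z. w * z) items zs) \<le> 1"

definition okp_gain :: "item list \<Rightarrow> real list \<Rightarrow> real" where
  "okp_gain items zs = sum_list (map2 (\<lambda>(v, w) z. v * z) items zs)"

definition okp_opt :: "item list \<Rightarrow> real" where
  "okp_opt items = Max {okp_gain items zs | zs. okp_feasible items zs}"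

text \<open>Competitiveness under the infinitesimal weight assumption: the ratio is bounded by \<open>\<alpha>\<close> in the
  limit where the largest weight tends to \<open>0\<close>, uniformly over all instances.\<close>
definition okp_competitive_infinitesimal ::
    "real \<Rightarrow> real \<Rightarrow> (item list \<Rightarrow> real list) \<Rightarrow> real \<Rightarrow> bool" where
  "okp_competitive_infinitesimal L U alg \<alpha> \<longleftrightarrow>
     (\<forall>\<epsilon>>0. \<exists>\<delta>>0. \<forall>items.
        okp_instance L U items \<and> (\<forall>(v, w)\<in>set items. w \<le> \<delta>) \<longrightarrow>
        okp_feasible items (alg items) \<and> okp_opt items \<le> (\<alpha> + \<epsilon>) * okp_gain items (alg items))"

text \<open>The threshold function \<open>\<phi>\<close> has domain \<open>[0, 1]\<close>, so the objective is only defined for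
  \<open>y + x \<le> 1\<close> (equivalently, \<open>\<phi> = \<infinity>\<close> beyond the capacity). Ties are broken in favour of the largest
  maximizer. For \<open>S = {0, w}\<close> this means accepting on equality. For trading it is indispensable:
  since \<open>\<phi>\<close> equals \<open>L\<close> on an initial segment, on rates all equal to \<open>L\<close> the choice \<open>x = 0\<close> is always a
  maximizer, but yields gain \<open>0\<close>.\<close>
definition unified_choice :: "(real \<Rightarrow> real) \<Rightarrow> real set \<Rightarrow> real \<Rightarrow> real \<Rightarrow> real" where
  "unified_choice \<phi> S b y =
     (GREATEST x. is_arg_max (\<lambda>x. b * x - integral {y..y + x} \<phi>) (\<lambda>x. x \<in> S \<and> y + x \<le> 1) x)"

text \<open>\<open>propose r y\<close> is the amount proposed for the arrival \<open>r\<close> at utilization \<open>y\<close>. A proposal that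
  exceeds the capacity is replaced by \<open>0\<close> and does not count towards the utilization.\<close>
fun allocate :: "('r \<Rightarrow> real \<Rightarrow> real) \<Rightarrow> real \<Rightarrow> 'r list \<Rightarrow> real list" where
  "allocate propose y [] = []"
| "allocate propose y (r # rs) =
     (let x = propose r y; x' = (if y + x > 1 then 0 else x)
      in x' # allocate propose (y + x') rs)"

definition unified_otp :: "(real \<Rightarrow> real) \<Rightarrow> real list \<Rightarrow> real list" where
  "unified_otp \<phi> bs = allocate (\<lambda>b y. unified_choice \<phi> {0..} b y) 0 bs"

text \<open>The decision \<open>z\<close> is recovered from the allocation \<open>x = w * z\<close>.\<close>
definition okp_decisions :: "item list \<Rightarrow> real list \<Rightarrow> real list" where
  "okp_decisions items xs = map2 (\<lambda>(v, w) x. x / w) items xs"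

definition unified_okp :: "(real \<Rightarrow> real) \<Rightarrow> item list \<Rightarrow> real list" where
  "unified_okp \<phi> items =
     okp_decisions items (allocate (\<lambda>(v, w) y. unified_choice \<phi> {0, w} (v / w) y) 0 items)"

text \<open>The pointwise acceptance rule \<open>v / w \<ge> \<phi> y\<close>. It agrees with maximizing the objective over
  \<open>{0, w}\<close> only in the limit of infinitesimal \<open>w\<close>, so for positive weights it is a separate
  algorithm.\<close>
definition unified_okp_pointwise :: "(real \<Rightarrow> real) \<Rightarrow> item list \<Rightarrow> real list" where
  "unified_okp_pointwise \<phi> items =
     okp_decisions items (allocate (\<lambda>(v, w) y. if v / w \<ge> \<phi> y then w else 0) 0 items)"

end

theory Submission
  imports Defs
begin

text \<open>Write \<open>\<Phi> y\<close> for the integral of \<open>\<phi>\<close> over \<open>[0, y]\<close>. The differential inequality makes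
  \<open>\<alpha> \<Phi> - \<psi>\<close> increasing, and \<open>\<alpha> \<omega> \<ge> 1\<close> makes it nonnegative at \<open>\<omega>\<close>; hence \<open>\<phi> \<le> \<alpha> \<Phi>\<close> on \<open>[\<omega>, 1]\<close>.

  For trading, if \<open>Y\<close> is the final utilization, then every rate is at most \<open>\<phi> Y\<close>, so \<open>OPT \<le> \<phi> Y\<close>, while
  every purchase is made at a rate above \<open>\<phi>\<close>, so \<open>ALG \<ge> \<Phi> Y\<close>.

  For the knapsack with weights at most \<open>\<delta>\<close>, either every item is accepted or \<open>Y + \<delta> \<ge> \<omega>\<close>. In the
  latter case put \<open>p = \<phi> (min 1 (Y + \<delta>))\<close>. Rejected items have ratio at most \<open>p\<close>; accepted items of
  larger ratio contribute the same excess \<open>E = \<Sum> max 0 (v - p w)\<close> to \<open>OPT \<le> p + E\<close> and to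
  \<open>ALG \<ge> \<Phi> Y + E - o(1)\<close>. Since \<open>p \<ge> L > 0\<close>, the additive error can be absorbed in the ratio.\<close>

section \<open>Upper bounds on the two offline optima\<close>

definition excess :: "real \<Rightarrow> item list \<Rightarrow> real" where
  "excess p items = (\<Sum>(v, w)\<leftarrow>items. max 0 (v - p * w))"

lemma excess_simps [simp]:
  "excess p [] = 0"
  "excess p ((v, w) # items) = max 0 (v - p * w) + excess p items"
  by (simp_all add: excess_def)

lemma excess_nonneg: "0 \<le> excess p items"
  by (induction items) auto

lemma otp_opt_le:
  assumes "\<And>b. b \<in> set bs \<Longrightarrow> b \<le> p" and "0 \<le> p"
  shows "otp_opt bs \<le> p"
  unfolding otp_opt_def
proof (rule cSup_least)
  have "otp_feasible bs (replicate (length bs) 0)"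
    by (auto simp: otp_feasible_def sum_list_replicate)
  then show "{otp_gain bs xs |xs. otp_feasible bs xs} \<noteq> {}"
    by blast
next
  fix g assume "g \<in> {otp_gain bs xs |xs. otp_feasible bs xs}"
  then obtain xs where g: "g = otp_gain bs xs" and len: "length bs = length xs"
    and nonneg: "\<forall>x\<in>set xs. 0 \<le> x" and cap: "sum_list xs \<le> 1"
    by (auto simp: otp_feasible_def)
  have "otp_gain bs xs \<le> p * sum_list xs"
    using len nonneg assms(1) unfolding otp_gain_def
  proof (induction bs xs rule: list_induct2)
    case (Cons b bs x xs)
    then have "b * x \<le> p * x"
      by (intro mult_right_mono) auto
    with Cons show ?case
      by (simp add: distrib_left add_mono)
  qed simp
  also have "\<dots> \<le> p"
    using cap \<open>0 \<le> p\<close> by (simp add: mult_left_le)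
  finally show "g \<le> p"
    using g by simp
qed

text \<open>Weak duality with \<open>p\<close> as the price of a unit of capacity: for
  \<open>z\<close> in \<open>{0, 1}\<close>, \<open>v * z\<close> is at most
  \<open>p * (w * z)\<close> plus the positive part of \<open>v - p * w\<close>, and the chosen
  weights sum to at most \<open>1\<close>. At \<open>p = 0\<close> the bound is the total value of
  all items.\<close>

lemma okp_opt_le:
  assumes pos: "\<And>v w. (v, w) \<in> set items \<Longrightarrow> 0 < w" and "0 \<le> p"
  shows "okp_opt items \<le> p + excess p items"
  unfolding okp_opt_def
proof (rule Max.boundedI)
  have "{okp_gain items zs |zs. okp_feasible items zs}
      \<subseteq> okp_gain items ` {zs. set zs \<subseteq> {0, 1} \<and> length zs = length items}"
    by (auto simp: okp_feasible_def)
  then show "finite {okp_gain items zs |zs. okp_feasible items zs}"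
    by (rule finite_subset) (simp add: finite_lists_length_eq)
next
  have "sum_list (map2 (\<lambda>(v, w) z. w * z) items (replicate (length items) 0)) = 0"
    by (induction items) auto
  then have "okp_feasible items (replicate (length items) 0)"
    by (auto simp: okp_feasible_def)
  then show "{okp_gain items zs |zs. okp_feasible items zs} \<noteq> {}"
    by blast
next
  fix g assume "g \<in> {okp_gain items zs |zs. okp_feasible items zs}"
  then obtain zs where g: "g = okp_gain items zs" and len: "length items = length zs"
    and bin: "set zs \<subseteq> {0, 1}" and cap: "sum_list (map2 (\<lambda>(v, w) z. w * z) items zs) \<le> 1"
    by (auto simp: okp_feasible_def)
  have "okp_gain items zs
      \<le> p * sum_list (map2 (\<lambda>(v, w) z. w * z) items zs) + excess p items"
    using len bin unfolding okp_gain_def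
  proof (induction items zs rule: list_induct2)
    case (Cons i items z zs)
    obtain v w where i: "i = (v, w)"
      by fastforce
    have "z = 0 \<or> z = 1"
      using Cons by auto
    then have "v * z \<le> p * (w * z) + max 0 (v - p * w)"
      by auto
    with Cons i show ?case
      by (simp add: distrib_left)
  qed simp
  also have "\<dots> \<le> p + excess p items"
    using cap \<open>0 \<le> p\<close> by (simp add: mult_left_le)
  finally show "g \<le> p + excess p items"
    using g by simp
qed

text \<open>The differential inequality enters only in the integrated form \<open>balance\<close>,
  so no derivative occurs inside the locale. The condition \<open>top\<close> ensures that every
  admissible rate is reached by \<phi>.\<close>

locale threshold =
  fixes L U \<alpha> \<omega> :: real and \<phi> :: "real \<Rightarrow> real"
  assumes L_pos: "0 < L" and alpha_ge: "1 \<le> \<alpha>" and omega: "0 \<le> \<omega>" "\<omega> \<le> 1"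
    and cont: "continuous_on {0..1} \<phi>"
    and mono: "mono_on {0..1} \<phi>"
    and flat: "\<And>y. y \<in> {0..\<omega>} \<Longrightarrow> \<phi> y = L"
    and top: "U \<le> \<phi> 1"
    and balance: "\<And>y. y \<in> {\<omega>..1} \<Longrightarrow> \<phi> y \<le> \<alpha> * integral {0..y} \<phi>"
begin

abbreviation \<Phi> :: "real \<Rightarrow> real" where
  "\<Phi> y \<equiv> integral {0..y} \<phi>"

lemma mono_le: "0 \<le> x \<Longrightarrow> x \<le> y \<Longrightarrow> y \<le> 1 \<Longrightarrow> \<phi> x \<le> \<phi> y"
  using mono by (auto simp: mono_on_def)

lemma ge_L: "y \<in> {0..1} \<Longrightarrow> L \<le> \<phi> y"
  using mono_le[of 0 y] flat[of 0] omega by auto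

lemma integrable: "0 \<le> x \<Longrightarrow> y \<le> 1 \<Longrightarrow> \<phi> integrable_on {x..y}"
  by (intro integrable_continuous_real continuous_on_subset[OF cont]) auto

lemma integral_eq_diff:
  assumes "0 \<le> x" "x \<le> y" "y \<le> 1"
  shows "integral {x..y} \<phi> = \<Phi> y - \<Phi> x"
  using Henstock_Kurzweil_Integration.integral_combine[of 0 x y \<phi>] integrable[of 0 y] assms
  by simp

lemma diff_bounds:
  assumes "0 \<le> x" "x \<le> y" "y \<le> 1"
  shows "\<phi> x * (y - x) \<le> \<Phi> y - \<Phi> x" and "\<Phi> y - \<Phi> x \<le> \<phi> y * (y - x)"
proof -
  have "integral {x..y} (\<lambda>_. \<phi> x) \<le> integral {x..y} \<phi>"
    using assms integrable by (intro integral_le) (auto intro: mono_le)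
  moreover have "integral {x..y} \<phi> \<le> integral {x..y} (\<lambda>_. \<phi> y)"
    using assms integrable by (intro integral_le) (auto intro: mono_le)
  ultimately show "\<phi> x * (y - x) \<le> \<Phi> y - \<Phi> x" "\<Phi> y - \<Phi> x \<le> \<phi> y * (y - x)"
    using assms integral_eq_diff[OF assms] by (auto simp: mult.commute)
qed

subsection \<open>One-way trading\<close>

text \<open>The intermediate value theorem makes the level set of \<open>b\<close> nonempty, and
  compactness gives it a last point. The last one is taken because \<phi> may have flat pieces and
  ties favour the largest maximizer; for \<open>b = L\<close> the level set contains
  \<omega>.\<close>

lemma obtain_level:
  assumes "b \<in> {L..U}"
  obtains Y where "Y \<in> {\<omega>..1}" "\<phi> Y = b" "\<And>t. Y < t \<Longrightarrow> t \<le> 1 \<Longrightarrow> b < \<phi> t"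
proof -
  let ?T = "{0..1} \<inter> \<phi> -` {b}"
  have "\<exists>t\<ge>0. t \<le> 1 \<and> \<phi> t = b"
    using assms top flat[of 0] omega cont by (intro IVT') auto
  then have "?T \<noteq> {}"
    by auto
  moreover have "closed ?T"
    using cont by (intro continuous_closed_preimage) auto
  then have "compact ?T"
    unfolding compact_eq_bounded_closed using bounded_subset[of "{0..1::real}" ?T] by auto
  ultimately obtain Y where Y: "Y \<in> ?T" and max: "\<And>t. t \<in> ?T \<Longrightarrow> t \<le> Y"
    using compact_attains_sup by metis
  have "\<omega> \<le> Y"
    using max[of \<omega>] Y flat[of Y] flat[of \<omega>] omega by fastforce
  moreover have "b < \<phi> t" if "Y < t" "t \<le> 1" for t
    using max[of t] mono_le[of Y t] Y that by force
  ultimately show thesis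
    using that[of Y] Y by auto
qed

text \<open>The last premise settles \<open>GREATEST\<close>: no maximizer lies to the right of
  \<open>x\<close>.\<close>

lemma unified_choice_eqI:
  assumes "x \<in> S" "y + x \<le> 1"
    and "\<And>x'. x' \<in> S \<Longrightarrow> y + x' \<le> 1 \<Longrightarrow>
      b * x' - integral {y..y + x'} \<phi> \<le> b * x - integral {y..y + x} \<phi>"
    and "\<And>x'. x' \<in> S \<Longrightarrow> y + x' \<le> 1 \<Longrightarrow> x < x' \<Longrightarrow>
      b * x' - integral {y..y + x'} \<phi> < b * x - integral {y..y + x} \<phi>"
  shows "unified_choice \<phi> S b y = x"
  unfolding unified_choice_def
proof (rule Greatest_equality)
  show "is_arg_max (\<lambda>x. b * x - integral {y..y + x} \<phi>) (\<lambda>x. x \<in> S \<and> y + x \<le> 1) x"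
    using assms by (auto simp: is_arg_max_def not_less)
next
  fix x' assume "is_arg_max (\<lambda>x. b * x - integral {y..y + x} \<phi>) (\<lambda>x. x \<in> S \<and> y + x \<le> 1) x'"
  then show "x' \<le> x"
    using assms unfolding is_arg_max_def by (meson not_le)
qed

text \<open>The marginal objective at utilization \<open>t\<close> is \<open>b - \<phi> t\<close>,
  which is nonnegative up to the last point \<open>Y\<close> with \<open>\<phi> Y = b\<close> and
  negative beyond it. So the algorithm buys up to \<open>Y\<close>, or nothing if utilization has
  already passed \<open>Y\<close>.\<close>

lemma unified_choice_otp:
  assumes b: "b \<in> {L..U}" and y: "y \<in> {0..1}"
  defines "x \<equiv> unified_choice \<phi> {0..} b y"
  shows "0 \<le> x" "y + x \<in> {\<omega>..1}" "b \<le> \<phi> (y + x)" "\<Phi> (y + x) - \<Phi> y \<le> b * x"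
proof -
  obtain Y where Y: "Y \<in> {\<omega>..1}" "\<phi> Y = b" and above: "\<And>t. Y < t \<Longrightarrow> t \<le> 1 \<Longrightarrow> b < \<phi> t"
    using obtain_level[OF b] by blast
  define m where "m = max y Y"
  have m: "y \<le> m" "0 \<le> m" "m \<le> 1" "Y \<le> m" "m \<in> {\<omega>..1}"
    using Y y omega by (auto simp: m_def)
  have strict: "b * (t - m) < \<Phi> t - \<Phi> m" if "m < t" "t \<le> 1" for t
  proof -
    \<comment> \<open>At \<open>m\<close> itself \<phi> may equal \<open>b\<close>, so the lower
      rectangle on the whole of \<open>{m..t}\<close> gives no strict inequality. From the midpoint
      on, \<phi> exceeds \<open>b\<close>, and the right half supplies the strictness.\<close>
    let ?h = "(m + t) / 2"
    have "b * (?h - m) \<le> \<phi> m * (?h - m)"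
      using mono_le[of Y m] Y m omega that by (intro mult_right_mono) auto
    also have "\<dots> \<le> \<Phi> ?h - \<Phi> m"
      using diff_bounds(1)[of m ?h] m that by auto
    finally have "b * (?h - m) \<le> \<Phi> ?h - \<Phi> m" .
    moreover have "b * (t - ?h) < \<phi> ?h * (t - ?h)"
      using above[of ?h] m that by (intro mult_strict_right_mono) auto
    moreover have "\<phi> ?h * (t - ?h) \<le> \<Phi> t - \<Phi> ?h"
      using diff_bounds(1)[of ?h t] m that by auto
    moreover have "b * (t - m) = b * (?h - m) + b * (t - ?h)"
      by (simp add: field_simps)
    ultimately show ?thesis
      by linarith
  qed
  have below: "\<Phi> m - \<Phi> t \<le> b * (m - t)" if "y \<le> t" "t \<le> m" for t
  proof (cases "m = Y")
    case True
    then show ?thesis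
      using diff_bounds(2)[of t m] that y m Y by auto
  next
    \<comment> \<open>Here \<open>m = y\<close>, so \<open>t = m\<close> and both sides
      vanish.\<close>
    case False
    then show ?thesis
      using that by (auto simp: m_def max_def split: if_splits)
  qed
  have x: "x = m - y"
    unfolding x_def
  proof (rule unified_choice_eqI)
    fix x' assume x': "x' \<in> {0..}" "y + x' \<le> 1"
    have eq: "integral {y..y + x'} \<phi> = \<Phi> (y + x') - \<Phi> y"
        "integral {y..y + (m - y)} \<phi> = \<Phi> m - \<Phi> y"
      using integral_eq_diff[of y "y + x'"] integral_eq_diff[of y m] x' y m by auto
    show gt: "b * x' - integral {y..y + x'} \<phi> < b * (m - y) - integral {y..y + (m - y)} \<phi>"
      if "m - y < x'"
      using strict[of "y + x'"] that x' eq by (simp add: algebra_simps)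
    show "b * x' - integral {y..y + x'} \<phi> \<le> b * (m - y) - integral {y..y + (m - y)} \<phi>"
      using gt below[of "y + x'"] x' eq by (cases "m - y < x'") (auto simp: algebra_simps)
  qed (use m in auto)
  show "0 \<le> x" "y + x \<in> {\<omega>..1}"
    using x m by auto
  show "b \<le> \<phi> (y + x)"
    using mono_le[of Y m] Y m omega x by auto
  show "\<Phi> (y + x) - \<Phi> y \<le> b * x"
    using below[of y] m x by auto
qed

text \<open>The one-step bounds on the gain telescope. Each rate is at most \<phi> at the
  utilization right after its arrival, and monotonicity carries this to the final utilization. The
  starting point \<open>y\<close> is arbitrary for the sake of the induction.\<close>

lemma allocate_otp:
  assumes "otp_instance L U bs" and "y \<in> {0..1}"
  defines "xs \<equiv> allocate (\<lambda>b y. unified_choice \<phi> {0..} b y) y bs"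
  shows "length xs = length bs" "\<forall>x\<in>set xs. 0 \<le> x" "y + sum_list xs \<in> {y..1}"
    "bs \<noteq> [] \<Longrightarrow> \<omega> \<le> y + sum_list xs" "\<forall>b\<in>set bs. b \<le> \<phi> (y + sum_list xs)"
    "\<Phi> (y + sum_list xs) - \<Phi> y \<le> otp_gain bs xs"
proof -
  have "length xs = length bs \<and> (\<forall>x\<in>set xs. 0 \<le> x) \<and> y + sum_list xs \<in> {y..1} \<and>
      (bs \<noteq> [] \<longrightarrow> \<omega> \<le> y + sum_list xs) \<and> (\<forall>b\<in>set bs. b \<le> \<phi> (y + sum_list xs)) \<and>
      \<Phi> (y + sum_list xs) - \<Phi> y \<le> otp_gain bs xs"
    using assms(1,2) unfolding xs_def
  proof (induction bs arbitrary: y)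
    case Nil
    then show ?case by (simp add: otp_gain_def)
  next
    case (Cons b bs)
    define x where "x = unified_choice \<phi> {0..} b y"
    define xs where "xs = allocate (\<lambda>b y. unified_choice \<phi> {0..} b y) (y + x) bs"
    have b: "b \<in> {L..U}" and bs: "otp_instance L U bs"
      using Cons.prems by (auto simp: otp_instance_def)
    note x = unified_choice_otp[OF b Cons.prems(2), folded x_def]
    have y': "y + x \<in> {0..1}"
      using x omega by auto
    \<comment> \<open>The choice respects the capacity, so the reset to \<open>0\<close> never
      happens.\<close>
    have alloc: "allocate (\<lambda>b y. unified_choice \<phi> {0..} b y) y (b # bs) = x # xs"
      using x by (simp add: Let_def x_def xs_def)
    note IH = Cons.IH[OF bs y', folded xs_def]
    have "b \<le> \<phi> (y + x + sum_list xs)"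
      using x(3) mono_le[of "y + x" "y + x + sum_list xs"] IH y' by auto
    then show ?case
      unfolding alloc using IH x by (auto simp: otp_gain_def algebra_simps)
  qed
  then show "length xs = length bs" "\<forall>x\<in>set xs. 0 \<le> x" "y + sum_list xs \<in> {y..1}"
    "bs \<noteq> [] \<Longrightarrow> \<omega> \<le> y + sum_list xs" "\<forall>b\<in>set bs. b \<le> \<phi> (y + sum_list xs)"
    "\<Phi> (y + sum_list xs) - \<Phi> y \<le> otp_gain bs xs"
    by blast+
qed

lemma unified_otp_competitive: "otp_competitive L U (unified_otp \<phi>) \<alpha>"
  unfolding otp_competitive_def
proof (intro allI impI conjI)
  fix bs assume bs: "otp_instance L U bs"
  define xs where "xs = unified_otp \<phi> bs"
  define Y where "Y = sum_list xs"
  note alloc = allocate_otp[OF bs, of 0, folded unified_otp_def, folded xs_def, simplified,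
      folded Y_def]
  show "otp_feasible bs (unified_otp \<phi> bs)"
    using alloc unfolding otp_feasible_def xs_def[symmetric] Y_def by auto
  show "otp_opt bs \<le> \<alpha> * otp_gain bs (unified_otp \<phi> bs)"
  \<comment> \<open>Without arrivals the utilization stays at \<open>0\<close>, where
    \<open>balance\<close> need not be available.\<close>
  proof (cases "bs = []")
    case True
    then show ?thesis
      using otp_opt_le[of "[]" 0] by (simp add: otp_gain_def)
  next
    case False
    have "otp_opt bs \<le> \<phi> Y"
      using alloc ge_L[of Y] L_pos by (intro otp_opt_le) auto
    also have "\<dots> \<le> \<alpha> * \<Phi> Y"
      using balance alloc False by auto
    also have "\<dots> \<le> \<alpha> * otp_gain bs xs"
      using alloc alpha_ge by (intro mult_left_mono) auto
    finally show ?thesis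
      by (simp add: xs_def)
  qed
qed

subsection \<open>Online knapsack\<close>

text \<open>The common abstraction of the two acceptance rules: both lie between accepting at \<open>\<phi> y\<close> and
  accepting at \<open>\<phi> (y + w)\<close>.\<close>

definition okp_rule :: "(item \<Rightarrow> real \<Rightarrow> real) \<Rightarrow> bool" where
  "okp_rule propose \<longleftrightarrow> (\<forall>v w y. 0 < w \<longrightarrow> y \<in> {0..1} \<longrightarrow> v / w \<in> {L..U} \<longrightarrow>
     propose (v, w) y = w \<and> (y + w \<le> 1 \<longrightarrow> \<phi> y \<le> v / w) \<or>
     propose (v, w) y = 0 \<and> (y + w \<le> 1 \<longrightarrow> v / w < \<phi> (y + w)))"

text \<open>An item that fits is accepted iff \<open>v\<close> is at least the integral of \<phi>
  over \<open>{y..y + w}\<close>, which lies between \<open>\<phi> y * w\<close> and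
  \<open>\<phi> (y + w) * w\<close>. For an item that does not fit, \<open>0\<close> is the only
  admissible choice.\<close>

lemma okp_rule_unified: "okp_rule (\<lambda>(v, w) y. unified_choice \<phi> {0, w} (v / w) y)"
  unfolding okp_rule_def split
proof (intro allI impI)
  fix v w y :: real
  assume w: "0 < w" and y: "y \<in> {0..1}" and "v / w \<in> {L..U}"
  have eq: "integral {y..y + w} \<phi> = \<Phi> (y + w) - \<Phi> y" if "y + w \<le> 1"
    using integral_eq_diff[of y "y + w"] that y w by auto
  have bounds: "\<phi> y * w \<le> \<Phi> (y + w) - \<Phi> y" "\<Phi> (y + w) - \<Phi> y \<le> \<phi> (y + w) * w"
    if "y + w \<le> 1"
    using diff_bounds[of y "y + w"] that y w by auto
  show "unified_choice \<phi> {0, w} (v / w) y = w \<and> (y + w \<le> 1 \<longrightarrow> \<phi> y \<le> v / w) \<or>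
      unified_choice \<phi> {0, w} (v / w) y = 0 \<and> (y + w \<le> 1 \<longrightarrow> v / w < \<phi> (y + w))"
  proof (cases "y + w \<le> 1 \<and> \<Phi> (y + w) - \<Phi> y \<le> v")
    case True
    then have "unified_choice \<phi> {0, w} (v / w) y = w"
      using w eq by (intro unified_choice_eqI) auto
    moreover have "\<phi> y \<le> v / w"
      using bounds(1) True w by (simp add: pos_le_divide_eq)
    ultimately show ?thesis
      by simp
  next
    case False
    then have "unified_choice \<phi> {0, w} (v / w) y = 0"
      using w y eq by (intro unified_choice_eqI) auto
    moreover have "v / w < \<phi> (y + w)" if "y + w \<le> 1"
      using bounds(2)[OF that] False that w by (simp add: pos_divide_less_eq)
    ultimately show ?thesis
      by simp
  qed
qed

text \<open>Rejection gives \<open>v / w < \<phi> y\<close>, and monotonicity does the rest. An item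
  that does not fit may still be proposed; \<open>okp_rule\<close> allows this, and
  \<open>allocate\<close> discards the proposal.\<close>

lemma okp_rule_pointwise: "okp_rule (\<lambda>(v, w) y. if v / w \<ge> \<phi> y then w else 0)"
  unfolding okp_rule_def
proof (intro allI impI)
  fix v w y :: real
  assume "0 < w" "y \<in> {0..1}" "v / w \<in> {L..U}"
  then show "(case (v, w) of (v, w) \<Rightarrow> \<lambda>y. if v / w \<ge> \<phi> y then w else 0) y = w \<and>
      (y + w \<le> 1 \<longrightarrow> \<phi> y \<le> v / w) \<or>
      (case (v, w) of (v, w) \<Rightarrow> \<lambda>y. if v / w \<ge> \<phi> y then w else 0) y = 0 \<and>
      (y + w \<le> 1 \<longrightarrow> v / w < \<phi> (y + w))"
    using mono_le[of y "y + w"] by auto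
qed

text \<open>Induction over the arrivals, where each accepted item loses at most
  \<open>\<eta> * w\<close> against the integral of \<phi>; the losses add up to \<eta> times the
  total accepted weight. The shift by \<delta> in the bound for \<open>p\<close> covers rejections,
  which only give a ratio below \<phi> at \<open>y + w\<close>.\<close>

lemma allocate_okp:
  assumes "okp_rule propose" and "okp_instance L U items" and "\<forall>(v, w)\<in>set items. w \<le> \<delta>"
    and "0 \<le> \<delta>" and "y \<in> {0..1}"
    and unif: "\<And>x y. 0 \<le> x \<Longrightarrow> x \<le> y \<Longrightarrow> y \<le> 1 \<Longrightarrow> y \<le> x + \<delta> \<Longrightarrow> \<phi> y \<le> \<phi> x + \<eta>"
  defines "xs \<equiv> allocate propose y items"
  defines "zs \<equiv> okp_decisions items xs"
  shows "length zs = length items" "set zs \<subseteq> {0, 1}"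
    "sum_list (map2 (\<lambda>(v, w) z. w * z) items zs) = sum_list xs"
    "y + sum_list xs \<in> {y..1}"
    "okp_gain items zs = excess 0 items \<or> \<omega> \<le> y + sum_list xs + \<delta>"
    "\<phi> (min 1 (y + sum_list xs + \<delta>)) \<le> p \<Longrightarrow>
      excess p items + \<Phi> (y + sum_list xs) - \<Phi> y - \<eta> * sum_list xs \<le> okp_gain items zs"
proof -
  have "length zs = length items \<and> set zs \<subseteq> {0, 1} \<and>
      sum_list (map2 (\<lambda>(v, w) z. w * z) items zs) = sum_list xs \<and>
      y + sum_list xs \<in> {y..1} \<and>
      (okp_gain items zs = excess 0 items \<or> \<omega> \<le> y + sum_list xs + \<delta>) \<and>
      (\<phi> (min 1 (y + sum_list xs + \<delta>)) \<le> p \<longrightarrow>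
        excess p items + \<Phi> (y + sum_list xs) - \<Phi> y - \<eta> * sum_list xs \<le> okp_gain items zs)"
    using assms(2,3,5) unfolding zs_def xs_def
  proof (induction items arbitrary: y)
    case Nil
    then show ?case by (simp add: okp_gain_def okp_decisions_def)
  next
    case (Cons i items)
    obtain v w where i: "i = (v, w)"
      by fastforce
    have v: "0 < v" and w: "0 < w" "w \<le> \<delta>" and r: "v / w \<in> {L..U}"
      and items: "okp_instance L U items" "\<forall>(v, w)\<in>set items. w \<le> \<delta>"
      using Cons.prems by (auto simp: okp_instance_def i)
    have y: "0 \<le> y" "y \<le> 1"
      using Cons.prems by auto
    have rule: "propose (v, w) y = w \<and> (y + w \<le> 1 \<longrightarrow> \<phi> y \<le> v / w) \<or>
        propose (v, w) y = 0 \<and> (y + w \<le> 1 \<longrightarrow> v / w < \<phi> (y + w))"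
      using \<open>okp_rule propose\<close> w r Cons.prems(3) by (simp add: okp_rule_def)
    show ?case
    proof (cases "propose (v, w) y = w \<and> y + w \<le> 1")
      case True
      define xs where "xs = allocate propose (y + w) items"
      define zs where "zs = okp_decisions items xs"
      have alloc: "allocate propose y (i # items) = w # xs"
        using True by (simp add: i Let_def xs_def)
      have dec: "okp_decisions (i # items) (w # xs) = 1 # zs"
        using w by (simp add: okp_decisions_def i zs_def)
      have "y + w \<in> {0..1}"
        using True y w by auto
      note IH = Cons.IH[OF items this, folded xs_def, folded zs_def]
      have "\<phi> y \<le> v / w"
        using rule True w by auto
      then have v_ge: "\<phi> y * w \<le> v"
        using w by (simp add: pos_le_divide_eq)
      have "\<Phi> (y + w) - \<Phi> y \<le> \<phi> (y + w) * w"
        using diff_bounds(2)[of y "y + w"] True y w by auto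
      also have "\<dots> \<le> (\<phi> y + \<eta>) * w"
        using unif[of y "y + w"] True y w by (intro mult_right_mono) auto
      finally have int: "\<Phi> (y + w) - \<Phi> y \<le> \<phi> y * w + \<eta> * w"
        by (simp add: algebra_simps)
      have "excess p (i # items) + \<Phi> (y + sum_list (w # xs)) - \<Phi> y - \<eta> * sum_list (w # xs)
          \<le> okp_gain (i # items) (1 # zs)" if p: "\<phi> (min 1 (y + sum_list (w # xs) + \<delta>)) \<le> p"
      proof -
        have "\<phi> y \<le> \<phi> (min 1 (y + sum_list (w # xs) + \<delta>))"
          using IH y w \<open>0 \<le> \<delta>\<close> by (intro mono_le) auto
        with p have "\<phi> y * w \<le> p * w"
          using w by (intro mult_right_mono) auto
        \<comment> \<open>If \<open>v - p * w\<close> is positive, use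
          \<open>v = (v - p * w) + p * w\<close> and \<open>\<phi> y * w \<le> p * w\<close>;
          otherwise use \<open>\<phi> y * w \<le> v\<close>. The integral exceeds
          \<open>\<phi> y * w\<close> by at most \<open>\<eta> * w\<close>.\<close>
        with v_ge int have "max 0 (v - p * w) + (\<Phi> (y + w) - \<Phi> y) - \<eta> * w \<le> v"
          by auto
        moreover have "excess p items + \<Phi> (y + w + sum_list xs) - \<Phi> (y + w) - \<eta> * sum_list xs
            \<le> okp_gain items zs"
          using IH p by (auto simp: add.assoc)
        ultimately show ?thesis
          by (simp add: okp_gain_def i algebra_simps)
      qed
      then show ?thesis
        unfolding alloc dec using IH v w by (auto simp: i okp_gain_def add.assoc)
    next
      case False
      define xs where "xs = allocate propose y items"
      define zs where "zs = okp_decisions items xs"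
      have alloc: "allocate propose y (i # items) = 0 # xs"
        using False rule w by (auto simp: i Let_def xs_def)
      have dec: "okp_decisions (i # items) (0 # xs) = 0 # zs"
        by (simp add: okp_decisions_def i zs_def)
      note IH = Cons.IH[OF items Cons.prems(3), folded xs_def, folded zs_def]
      \<comment> \<open>If the item does not fit, the bound is
        \<open>v / w \<le> U \<le> \<phi> 1\<close>.\<close>
      have v_le: "v / w \<le> \<phi> (min 1 (y + w))"
        using False rule r top w by (auto simp: min_def)
      \<comment> \<open>A rejected item that fits has ratio at least \<open>L\<close>, so
        \<open>\<phi> (y + w)\<close> is already above the flat value. One that does not fit has
        \<open>y + w > 1\<close>.\<close>
      have "\<omega> \<le> y + w"
      proof (cases "y + w \<le> 1")
        case True
        then have "L < \<phi> (y + w)"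
          using False rule r w by auto
        then show ?thesis
          using flat[of "y + w"] y w by force
      qed (use omega in auto)
      moreover have "max 0 (v - p * w) = 0"
        if p: "\<phi> (min 1 (y + sum_list xs + \<delta>)) \<le> p"
      proof -
        have "\<phi> (min 1 (y + w)) \<le> \<phi> (min 1 (y + sum_list xs + \<delta>))"
          using IH y w by (intro mono_le) auto
        with v_le p have "v / w \<le> p"
          by simp
        then show ?thesis
          using w by (simp add: pos_divide_le_eq)
      qed
      ultimately show ?thesis
        unfolding alloc dec using IH w by (auto simp: i okp_gain_def)
    qed
  qed
  then show "length zs = length items" "set zs \<subseteq> {0, 1}"
    "sum_list (map2 (\<lambda>(v, w) z. w * z) items zs) = sum_list xs"
    "y + sum_list xs \<in> {y..1}"
    "okp_gain items zs = excess 0 items \<or> \<omega> \<le> y + sum_list xs + \<delta>"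
    "\<phi> (min 1 (y + sum_list xs + \<delta>)) \<le> p \<Longrightarrow>
      excess p items + \<Phi> (y + sum_list xs) - \<Phi> y - \<eta> * sum_list xs \<le> okp_gain items zs"
    by (elim conjE; blast)+
qed

lemma okp_rule_competitive:
  assumes rule: "okp_rule propose"
  shows "okp_competitive_infinitesimal L U
    (\<lambda>items. okp_decisions items (allocate propose 0 items)) \<alpha>"
  unfolding okp_competitive_infinitesimal_def
proof (intro allI impI)
  fix \<epsilon> :: real assume \<epsilon>: "0 < \<epsilon>"
  \<comment> \<open>The total additive error. The first bound gives
    \<open>\<alpha> * s \<le> L / 2\<close>, which forces \<open>\<alpha> * G \<ge> L / 2\<close>;
    the second then gives \<open>\<alpha> * s \<le> \<epsilon> * G\<close>. Half of \<open>s\<close>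
    pays for the oscillation of \<phi> along accepted items, half for moving from \<open>Y\<close>
    to \<open>Y + \<delta>\<close>.\<close>
  define s where "s = min (L / (2 * \<alpha>)) (\<epsilon> * L / (2 * \<alpha> * \<alpha>))"
  have s: "0 < s" "s \<le> L / (2 * \<alpha>)" "s \<le> \<epsilon> * L / (2 * \<alpha> * \<alpha>)"
    using L_pos alpha_ge \<epsilon> by (auto simp: s_def)
  define \<eta> where "\<eta> = s / 2"
  have "0 < \<eta>"
    using s by (simp add: \<eta>_def)
  moreover have "uniformly_continuous_on {0..1} \<phi>"
    using cont by (intro compact_uniformly_continuous) auto
  ultimately obtain d where d: "0 < d"
    and d_unif: "\<And>x y. x \<in> {0..1} \<Longrightarrow> y \<in> {0..1} \<Longrightarrow> dist y x < d \<Longrightarrow> dist (\<phi> y) (\<phi> x) < \<eta>"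
    unfolding uniformly_continuous_on_def by metis
  define M where "M = \<phi> 1"
  have M: "0 < M"
    using ge_L[of 1] L_pos by (simp add: M_def)
  \<comment> \<open>The first bound keeps \<delta> strictly below \<open>d\<close>; the second
    bounds by \<eta> the integral of \<phi> over any subinterval of length at most \<delta>.\<close>
  define \<delta> where "\<delta> = min (d / 2) (\<eta> / M)"
  have \<delta>: "0 < \<delta>" "\<delta> < d"
    using d M \<open>0 < \<eta>\<close> by (auto simp: \<delta>_def)
  have "\<delta> * M \<le> \<eta> / M * M"
    using M by (intro mult_right_mono) (auto simp: \<delta>_def)
  with M have \<delta>M: "M * \<delta> \<le> \<eta>"
    by (simp add: mult.commute)
  have unif: "\<phi> y \<le> \<phi> x + \<eta>" if "0 \<le> x" "x \<le> y" "y \<le> 1" "y \<le> x + \<delta>" for x y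
    using d_unif[of x y] that \<delta> by (auto simp: dist_real_def)
  show "\<exists>\<delta>>0. \<forall>items. okp_instance L U items \<and> (\<forall>(v, w)\<in>set items. w \<le> \<delta>) \<longrightarrow>
      okp_feasible items (okp_decisions items (allocate propose 0 items)) \<and>
      okp_opt items \<le> (\<alpha> + \<epsilon>) *
        okp_gain items (okp_decisions items (allocate propose 0 items))"
  proof (intro exI[of _ \<delta>] conjI allI impI \<open>0 < \<delta>\<close>; elim conjE)
    fix items assume inst: "okp_instance L U items" and small: "\<forall>(v, w)\<in>set items. w \<le> \<delta>"
    define xs where "xs = allocate propose 0 items"
    define zs where "zs = okp_decisions items xs"
    define Y where "Y = sum_list xs"
    define G where "G = okp_gain items zs"
    note alloc = allocate_okp[OF rule inst small less_imp_le[OF \<open>0 < \<delta>\<close>] _ unif, of 0,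
        folded xs_def, folded zs_def, folded G_def Y_def, simplified]
    show "okp_feasible items (okp_decisions items (allocate propose 0 items))"
      unfolding xs_def[symmetric] zs_def[symmetric] okp_feasible_def using alloc by auto
    have pos: "0 < w" if "(v, w) \<in> set items" for v w
      using inst that by (auto simp: okp_instance_def)
    show "okp_opt items \<le> (\<alpha> + \<epsilon>) *
        okp_gain items (okp_decisions items (allocate propose 0 items))"
      unfolding xs_def[symmetric] zs_def[symmetric] G_def[symmetric]
    proof (cases "G = excess 0 items")
      \<comment> \<open>The gain is the total value of all items, which is the duality bound at
        price \<open>0\<close>.\<close>
      case True
      have "okp_opt items \<le> G"
        using okp_opt_le[of items 0] pos True by auto
      also have "\<dots> \<le> (\<alpha> + \<epsilon>) * G"
        using True excess_nonneg[of 0 items] alpha_ge \<epsilon> by (simp add: mult_le_cancel_right1)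
      finally show "okp_opt items \<le> (\<alpha> + \<epsilon>) * G" .
    next
      case False
      \<comment> \<open>\<open>balance\<close> holds only from \<omega> on, and \<open>Y\<close> may
        fall short of \<omega> by up to \<delta>; hence it is applied at \<open>Y'\<close>.\<close>
      define Y' where "Y' = min 1 (Y + \<delta>)"
      define p where "p = \<phi> Y'"
      have Y: "0 \<le> Y" "Y \<le> 1" and "\<omega> \<le> Y + \<delta>"
        using alloc False by auto
      then have Y': "Y' \<in> {\<omega>..1}" "Y \<le> Y'" "Y' - Y \<le> \<delta>" "0 \<le> Y'"
        using omega \<delta> by (auto simp: Y'_def)
      have p: "L \<le> p"
        using Y' by (auto simp: p_def intro: ge_L)
      have gain: "excess p items + \<Phi> Y - \<eta> * Y \<le> G"
        using alloc(6)[of p] by (simp add: p_def Y'_def)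
      have "\<eta> * Y \<le> \<eta>"
        using Y \<open>0 < \<eta>\<close> by (simp add: mult_left_le)
      have "\<Phi> Y' - \<Phi> Y \<le> \<phi> Y' * (Y' - Y)"
        using diff_bounds(2)[of Y Y'] Y Y' by auto
      also have "\<dots> \<le> M * \<delta>"
        using Y Y' p L_pos M mono_le[of Y' 1] by (intro mult_mono) (auto simp: p_def M_def)
      finally have "\<Phi> Y' \<le> \<Phi> Y + \<eta>"
        using \<delta>M by simp
      with gain \<open>\<eta> * Y \<le> \<eta>\<close> have "\<Phi> Y' \<le> G - excess p items + s"
        by (simp add: \<eta>_def)
      then have "\<alpha> * \<Phi> Y' \<le> \<alpha> * (G - excess p items + s)"
        using alpha_ge by (intro mult_left_mono) auto
      then have p_le: "p \<le> \<alpha> * (G - excess p items + s)"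
        using balance[OF Y'(1)] by (simp add: p_def)
      \<comment> \<open>The excess enters the bound on the optimum with factor \<open>1\<close> and
        the gain, scaled by \<alpha>, with factor \<alpha>, so it cancels in favour of the
        algorithm.\<close>
      have excess: "excess p items \<le> \<alpha> * excess p items"
        using alpha_ge excess_nonneg[of p items] by (simp add: mult_le_cancel_right1)
      have "\<alpha> * s \<le> L / 2"
        using s(2) alpha_ge by (simp add: field_simps)
      with p_le p excess excess_nonneg[of p items] have "L / 2 \<le> \<alpha> * G"
        by (simp add: algebra_simps)
      have "\<alpha> * s \<le> \<epsilon> * L / (2 * \<alpha>)"
        using s(3) alpha_ge by (simp add: field_simps)
      also have "\<dots> = \<epsilon> * (L / 2) / \<alpha>"
        by simp
      also have "\<dots> \<le> \<epsilon> * (\<alpha> * G) / \<alpha>"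
        using \<open>L / 2 \<le> \<alpha> * G\<close> \<epsilon> alpha_ge by (intro divide_right_mono mult_left_mono) auto
      also have "\<dots> = \<epsilon> * G"
        using alpha_ge by simp
      finally have "\<alpha> * s \<le> \<epsilon> * G" .
      moreover have "okp_opt items \<le> p + excess p items"
        using pos p L_pos by (intro okp_opt_le) auto
      ultimately show "okp_opt items \<le> (\<alpha> + \<epsilon>) * G"
        using p_le excess by (simp add: algebra_simps)
    qed
  qed
qed

end

section \<open>From the differential inequality to the assumptions of
  \<open>threshold\<close>\<close>

theorem theorem1:
  fixes L U \<alpha> \<omega> :: real and \<psi> \<psi>' \<phi> :: "real \<Rightarrow> real"
  assumes "0 < L" and "L < U" and "\<alpha> \<ge> 1"
    and "1 / \<alpha> \<le> \<omega>" and "\<omega> \<le> 1"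
    and "\<forall>y\<in>{\<omega>..1}. 0 \<le> \<psi> y"
    and "mono_on {\<omega>..1} \<psi>"
    and "\<forall>y\<in>{\<omega>..1}. (\<psi> has_real_derivative \<psi>' y) (at y within {\<omega>..1})"
    and "\<forall>y\<in>{\<omega>..1}. \<psi> y \<ge> 1 / \<alpha> * \<psi>' y"
    and "\<psi> \<omega> = L" and "\<psi> 1 \<ge> U"
    and "\<forall>y\<in>{0..\<omega>}. \<phi> y = L"
    and "\<forall>y\<in>{\<omega>..1}. \<phi> y = \<psi> y"
  shows "otp_competitive L U (unified_otp \<phi>) \<alpha>
    \<and> okp_competitive_infinitesimal L U (unified_okp \<phi>) \<alpha>
    \<and> okp_competitive_infinitesimal L U (unified_okp_pointwise \<phi>) \<alpha>"
proof -
  \<comment> \<open>Otherwise \<open>\<psi> 1 = L\<close>, against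
    \<open>L < U \<le> \<psi> 1\<close>.\<close>
  have "\<omega> < 1"
    using assms by (cases "\<omega> = 1") auto
  have "0 < \<omega>"
    using assms by (smt (verit) divide_pos_pos)
  have cont_psi: "continuous_on {\<omega>..1} \<psi>"
    using assms(8) by (intro DERIV_continuous_on) auto
  have cont: "continuous_on {0..1} \<phi>"
  proof -
    have "continuous_on ({0..\<omega>} \<union> {\<omega>..1}) \<phi>"
    proof (rule continuous_on_closed_Un)
      show "continuous_on {0..\<omega>} \<phi>"
        using assms(12) by (subst continuous_on_cong[OF refl, of _ _ "\<lambda>_. L"]) auto
      show "continuous_on {\<omega>..1} \<phi>"
        using assms(13) cont_psi by (subst continuous_on_cong[OF refl, of _ _ \<psi>]) auto
    qed auto
    moreover have "{0..\<omega>} \<union> {\<omega>..1} = {0..1}"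
      using \<open>0 < \<omega>\<close> \<open>\<omega> < 1\<close> by auto
    ultimately show ?thesis
      by simp
  qed
  have mono: "mono_on {0..1} \<phi>"
  proof (rule mono_onI)
    fix x y :: real
    assume xy: "x \<in> {0..1}" "y \<in> {0..1}" "x \<le> y"
    have psi: "\<psi> a \<le> \<psi> b" if "\<omega> \<le> a" "a \<le> b" "b \<le> 1" for a b
      using assms(7) that by (auto simp: mono_on_def)
    show "\<phi> x \<le> \<phi> y"
      using assms(10,12,13) xy psi[of x y] psi[of \<omega> y]
      by (cases "x \<le> \<omega>"; cases "y \<le> \<omega>") auto
  qed
  have balance: "\<phi> y \<le> \<alpha> * integral {0..y} \<phi>" if y: "y \<in> {\<omega>..1}" for y
  proof -
    let ?F = "\<lambda>y. \<alpha> * integral {0..y} \<phi> - \<psi> y"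
    have deriv: "(?F has_real_derivative \<alpha> * \<phi> t - \<psi>' t) (at t within {\<omega>..1})"
      if "t \<in> {\<omega>..1}" for t
    proof -
      have "((\<lambda>y. integral {0..y} \<phi>) has_real_derivative \<phi> t) (at t within {0..1})"
        using integral_has_real_derivative[OF cont] that \<open>0 < \<omega>\<close> by auto
      then have "((\<lambda>y. integral {0..y} \<phi>) has_real_derivative \<phi> t) (at t within {\<omega>..1})"
        by (rule DERIV_subset) (use \<open>0 < \<omega>\<close> in auto)
      then show ?thesis
        using assms(8) that by (intro DERIV_diff DERIV_cmult) auto
    qed
    have "?F \<omega> \<le> ?F y"
    \<comment> \<open>Only interior points need a two-sided derivative, and there the derivative
      within \<open>{\<omega>..1}\<close> is one; at the endpoints continuity suffices.\<close>
    proof (rule DERIV_nonneg_imp_increasing_open[where f = ?F])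
      fix t assume t: "\<omega> < t" "t < y"
      have "(?F has_real_derivative \<alpha> * \<phi> t - \<psi>' t) (at t)"
        using deriv[of t] t y at_within_Icc_at[of \<omega> t 1] by auto
      moreover have "\<psi>' t \<le> \<alpha> * \<phi> t"
        using assms(3,9,13) t y by (simp add: field_simps)
      ultimately show "\<exists>f'. (?F has_real_derivative f') (at t) \<and> 0 \<le> f'"
        by auto
    next
      have "continuous_on {\<omega>..1} ?F"
        using deriv by (rule DERIV_continuous_on)
      then show "continuous_on {\<omega>..y} ?F"
        by (rule continuous_on_subset) (use y in auto)
    qed (use y in auto)
    moreover have "integral {0..\<omega>} \<phi> = \<omega> * L"
      using integral_cong[of "{0..\<omega>}" \<phi> "\<lambda>_. L"] assms(12) \<open>0 < \<omega>\<close> by auto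
    \<comment> \<open>Since \<open>\<psi> \<omega> = L\<close>, this says that \<open>?F\<close> is
      nonnegative at \<omega>.\<close>
    moreover have "1 * L \<le> (\<alpha> * \<omega>) * L"
      using assms(1,3,4) by (intro mult_right_mono) (auto simp: field_simps)
    ultimately show ?thesis
      using assms(10,13) y by (simp add: mult.assoc)
  qed
  interpret threshold L U \<alpha> \<omega> \<phi>
    using assms \<open>0 < \<omega>\<close> cont mono balance by unfold_locales auto
  show ?thesis
    using unified_otp_competitive okp_rule_competitive[OF okp_rule_unified]
      okp_rule_competitive[OF okp_rule_pointwise]
    unfolding unified_okp_def[abs_def] unified_okp_pointwise_def[abs_def] by blast
qed

end
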